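(* Let $L_k(x)$ denote the Lucas polynomials, defined by $L_0(x)=2$, $L_1(x)=x$, and $L_k(x)=xL_{k-1}(x)+L_{k-2}(x)$ for $k\ge2$. Then for every nonnegative integer $n$ and every complex number $x$ for which the denominator below is nonzero, $$e^{L_n(x)}=\dfrac{\displaystyle\sum_{k=0}^\infty\frac{L_{nk}(x)}{k!}}{\displaystyle\sum_{k=0}^\infty(-1)^k\frac{L_{nk}(x)}{k!}}.$$
   Context: The Lucas polynomials satisfy $L_k(x)=\left(\frac{x+\sqrt{x^2+4}}{2}\right)^k+\left(\frac{x-\sqrt{x^2+4}}{2}\right)^k$. *)

theory Defs
  imports Complex_Main "HOL-Computational_Algebra.Polynomial"
begin

fun lucas_poly :: "nat \<Rightarrow> 'a::comm_ring_1 poly" where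
  "lucas_poly 0 = [:2:]"
| "lucas_poly (Suc 0) = [:0, 1:]"
| "lucas_poly (Suc (Suc k)) = [:0, 1:] * lucas_poly (Suc k) + lucas_poly k"

end

theory Submission
  imports Defs
begin

text \<open>By Binet's formula the two series are \<open>exp (a ^ n) + exp (b ^ n)\<close> and
  \<open>exp (- a ^ n) + exp (- b ^ n)\<close>, where \<open>a\<close> and \<open>b\<close> are the roots of \<open>t\<^sup>2 = x t + 1\<close>;
  their quotient is \<open>exp (a ^ n + b ^ n)\<close>.\<close>

text \<open>Both sides satisfy the same recurrence: power sums of two elements obey Newton's
  identity, whose coefficients here are \<open>a + b = x\<close> and \<open>- (a * b) = 1\<close>.
  Prescribing only sum and product avoids square roots and division, so any commutative ring will
  do.\<close>

lemma poly_lucas_poly_binet: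
  fixes a b :: "'a::comm_ring_1"
  assumes "a + b = x" "a * b = -1"
  shows "poly (lucas_poly k) x = a ^ k + b ^ k"
proof (induction k rule: lucas_poly.induct)
  case (3 k)
  have "a ^ Suc (Suc k) + b ^ Suc (Suc k) = (a + b) * (a ^ Suc k + b ^ Suc k) - a * b * (a ^ k + b ^ k)"
    by (simp add: algebra_simps)
  with 3 assms show ?case by simp
qed (use assms in auto)

text \<open>Quadratic formula for t^2 - x t - 1, with discriminant
  \<open>x\<^sup>2 + 4\<close>.\<close>

lemma binet_roots_exist:
  fixes x :: complex
  obtains a b where "a + b = x" "a * b = -1"
proof
  let ?s = "csqrt (x\<^sup>2 + 4)"
  show "(x + ?s) / 2 + (x - ?s) / 2 = x"
    by (simp add: field_simps)
  have "(x + ?s) / 2 * ((x - ?s) / 2) = (x\<^sup>2 - ?s\<^sup>2) / 4"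
    by (simp add: algebra_simps power2_eq_square)
  then show "(x + ?s) / 2 * ((x - ?s) / 2) = -1"
    by simp
qed

lemma exp_sums_divide_fact: "(\<lambda>k. z ^ k / fact k) sums exp z" for z :: complex
  using exp_converges[of z] by (simp add: scaleR_conv_of_real field_simps)

theorem theorem5:
  fixes n :: nat and x :: complex
  assumes "(\<Sum>k. (-1) ^ k * (poly (lucas_poly (n * k)) x / fact k)) \<noteq> 0"
  shows "summable (\<lambda>k. poly (lucas_poly (n * k)) x / fact k)
    \<and> summable (\<lambda>k. (-1) ^ k * (poly (lucas_poly (n * k)) x / fact k))
    \<and> exp (poly (lucas_poly n) x)
        = (\<Sum>k. poly (lucas_poly (n * k)) x / fact k)
          / (\<Sum>k. (-1) ^ k * (poly (lucas_poly (n * k)) x / fact k))"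
proof -
  obtain a b where ab: "a + b = x" "a * b = -1"
    by (rule binet_roots_exist)
  note binet = poly_lucas_poly_binet[OF ab]
  have num: "(\<lambda>k. poly (lucas_poly (n * k)) x / fact k) sums (exp (a ^ n) + exp (b ^ n))"
    using sums_add[OF exp_sums_divide_fact[of "a ^ n"] exp_sums_divide_fact[of "b ^ n"]]
    by (simp add: binet power_mult add_divide_distrib)
  \<comment> \<open>The alternating sign is absorbed into the base:
    \<open>(-1) ^ k * (a ^ n) ^ k = (- (a ^ n)) ^ k\<close>, and likewise for
    \<open>b\<close>.\<close>
  have den: "(\<lambda>k. (-1) ^ k * (poly (lucas_poly (n * k)) x / fact k))
      sums (exp (- (a ^ n)) + exp (- (b ^ n)))"
    using sums_add[OF exp_sums_divide_fact[of "- (a ^ n)"] exp_sums_divide_fact[of "- (b ^ n)"]]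
    by (simp add: binet power_mult add_divide_distrib power_minus[of "a ^ n"]
        power_minus[of "b ^ n"] distrib_left)
  have nz: "exp (- (a ^ n)) + exp (- (b ^ n)) \<noteq> 0"
    using assms sums_unique[OF den] by simp
  \<comment> \<open>Multiplying out swaps the two terms: the factor turns
    \<open>exp (- (a ^ n))\<close> into \<open>exp (b ^ n)\<close> and
    \<open>exp (- (b ^ n))\<close> into \<open>exp (a ^ n)\<close>.\<close>
  have "exp (a ^ n + b ^ n) * (exp (- (a ^ n)) + exp (- (b ^ n))) = exp (a ^ n) + exp (b ^ n)"
    by (simp add: distrib_left flip: exp_add)
  then have "exp (poly (lucas_poly n) x)
      = (exp (a ^ n) + exp (b ^ n)) / (exp (- (a ^ n)) + exp (- (b ^ n)))"
    using nz by (simp add: binet eq_divide_eq)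
  then show ?thesis
    unfolding sums_unique[OF num, symmetric] sums_unique[OF den, symmetric]
    using num[THEN sums_summable] den[THEN sums_summable] by (intro conjI)
qed

end
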